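(* Let $S_{\rm lcm}(n)$ denote the set of permutations $\pi$ of $[n]=\{1,\dots,n\}$ such that $\operatorname{lcm}[j,\pi(j)]\le n$ for every $j\in[n]$, and let $S_{\rm div}(n)$ denote the set of permutations $\pi$ of $[n]$ such that for every $j\in[n]$, $j\mid\pi(j)$ or $\pi(j)\mid j$. Let $R(n)=\#S_{\rm lcm}(n)/\#S_{\rm div}(n)$. There is a constant $c>1$ such that $R(n)>c^n$ for all sufficiently large $n$. *)

theory Defs
  imports Complex_Main "HOL-Combinatorics.Permutations"
begin

definition S_lcm :: "nat \<Rightarrow> (nat \<Rightarrow> nat) set" where
  "S_lcm n = {\<pi>. \<pi> permutes {1..n} \<and> (\<forall>j\<in>{1..n}. lcm j (\<pi> j) \<le> n)}"

definition S_div :: "nat \<Rightarrow> (nat \<Rightarrow> nat) set" where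
  "S_div n = {\<pi>. \<pi> permutes {1..n} \<and> (\<forall>j\<in>{1..n}. j dvd \<pi> j \<or> \<pi> j dvd j)}"

(* S_div n contains the identity, so the denominator is never 0. *)
definition R :: "nat \<Rightarrow> real" where
  "R n = real (card (S_lcm n)) / real (card (S_div n))"

end

theory Submission
  imports Defs "HOL-Library.FuncSet"
begin

text \<open>
  Let \<open>Q = 84!\<close> and call \<open>m\<close> rough if it is coprime to \<open>Q\<close>. For rough \<open>m\<close> with
  \<open>n/7 < m \<le> n/6\<close>, the blocks \<open>{m, 2m, \<dots>, 6m}\<close> are pairwise disjoint. A permutation in
  \<open>S_div n\<close> can leave such a block only by dividing out a factor of \<open>m\<close>, which exceeds 84;
  the image is then \<open>r t\<close> with \<open>r\<close> rough, \<open>r \<le> n/504\<close> and \<open>t \<le> 6\<close>. Rough numbers have positive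
  density \<open>\<rho>\<close>, so there are about \<open>\<rho>n/42\<close> blocks and at most about \<open>\<rho>n/84\<close> of them are left:
  linearly many blocks are preserved, whatever the size of \<open>\<rho>\<close>.

  On any set \<open>T\<close> of preserved blocks, replace the permutation by the exchange of \<open>2m\<close> and \<open>3m\<close>.
  The result is in \<open>S_lcm n\<close> because \<open>lcm (2m) (3m) = 6m \<le> n\<close>, and \<open>T\<close> can be read off as the set
  of \<open>m\<close> where divisibility fails at \<open>2m\<close>. Only the at most \<open>6^6\<close> possible maps on each block of
  \<open>T\<close> are forgotten, so giving \<open>T\<close> the weight \<open>(1/6^6)^|T|\<close> yields
  \<open>\<Sum>\<pi>\<in>S_div n. (1 + 1/6^6)^g(\<pi>) \<le> |S_lcm n|\<close>, where \<open>g(\<pi>)\<close> counts the blocks preserved by \<open>\<pi>\<close>.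
\<close>

section \<open>Blocks of multiples of rough numbers\<close>

text \<open>There are about \<rho>n/42 sites, and leaving blocks by a factor above \<open>K\<close>
  yields at most about \<rho>n/K images; \<open>K = 84\<close> makes this half the sites. The
  factorial has every number from 1 to 84 as a divisor.\<close>

definition Q :: nat where
  "Q = fact 84"

definition block :: "nat \<Rightarrow> nat set" where
  "block m = (\<lambda>s. m * s) ` {1..6}"

text \<open>\<open>n < 7 * m\<close> makes \<open>block m\<close> contain all multiples of
  \<open>m\<close> in \<open>{1..n}\<close>; \<open>6 * m \<le> n\<close> leaves room for the lcm of
  \<open>2 * m\<close> and \<open>3 * m\<close>.\<close>

definition sites :: "nat \<Rightarrow> nat set" where
  "sites n = {m. 6 * m \<le> n \<and> n < 7 * m \<and> coprime m Q}"

definition good :: "nat \<Rightarrow> (nat \<Rightarrow> nat) \<Rightarrow> nat set" where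
  "good n \<pi> = {m \<in> sites n. \<pi> ` block m \<subseteq> block m}"

lemma coprime_Q_small:
  assumes "coprime m Q" "1 \<le> s" "s \<le> 84"
  shows "coprime m s"
proof -
  have "s dvd Q" unfolding Q_def using assms by (intro dvd_fact) auto
  then show ?thesis using assms(1) coprime_divisors[of m m s Q] by simp
qed

lemma coprime_Q_divisor_gt:
  assumes "coprime m Q" "d dvd m" "d \<noteq> 1" "m > 0"
  shows "d > 84"
proof (rule ccontr)
  assume "\<not> d > 84"
  moreover have "d > 0" using assms(2,4) by (auto intro: dvd_pos_nat)
  ultimately have "coprime m d" using coprime_Q_small[OF assms(1), of d] by simp
  then show False using assms(2,3) by (metis coprime_absorb_right is_unit_gcd_iff nat_dvd_1_iff_1)
qed

text \<open>In \<open>m * s = m' * s'\<close> the rough \<open>m\<close> is coprime to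
  \<open>s'\<close>, so it divides \<open>m'\<close>, and symmetrically.\<close>

lemma block_inj:
  assumes "coprime m Q" "coprime m' Q" "x \<in> block m" "x \<in> block m'"
  shows "m = m'"
proof -
  obtain s s' where s: "1 \<le> s" "s \<le> 6" "1 \<le> s'" "s' \<le> 6" "x = m * s" "x = m' * s'"
    using assms(3,4) unfolding block_def by auto
  have "coprime m s'" "coprime m' s" using assms s by (auto intro!: coprime_Q_small)
  moreover have "m dvd m' * s'" "m' dvd m * s" using s by (metis dvd_triv_left)+
  ultimately have "m dvd m'" "m' dvd m" by (simp_all add: coprime_dvd_mult_left_iff)
  then show ?thesis by (rule dvd_antisym)
qed

lemma finite_sites [simp]: "finite (sites n)"
  by (rule finite_subset[of _ "{..n}"]) (auto simp: sites_def)

lemma block_subset: "m \<in> sites n \<Longrightarrow> block m \<subseteq> {1..n}"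
proof
  fix x assume m: "m \<in> sites n" and "x \<in> block m"
  then obtain s where s: "1 \<le> s" "s \<le> 6" "x = m * s" by (auto simp: block_def)
  have "x \<le> m * 6" unfolding s(3) using s(2) by (rule mult_le_mono2)
  also have "\<dots> \<le> n" using m by (simp add: sites_def)
  finally show "x \<in> {1..n}" using m s by (auto simp: sites_def)
qed

lemma finite_block [simp]: "finite (block m)"
  by (simp add: block_def)

lemma card_block: "m > 0 \<Longrightarrow> card (block m) = 6"
  by (simp add: block_def card_image inj_on_def)

section \<open>Most blocks are preserved\<close>

lemma image_outside_block:
  assumes \<pi>: "\<pi> \<in> S_div n" and m: "m \<in> sites n" and x: "x \<in> block m" and out: "\<pi> x \<notin> block m"
  shows "\<exists>r t. \<pi> x = r * t \<and> 504 * r \<le> n \<and> coprime r Q \<and> t \<in> {1..6}"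
proof -
  obtain s where s: "1 \<le> s" "s \<le> 6" "x = m * s" using x by (auto simp: block_def)
  have mn: "6 * m \<le> n" "n < 7 * m" "coprime m Q" and m0: "m > 0" using m by (auto simp: sites_def)
  have xn: "x \<in> {1..n}" using block_subset[OF m] x by auto
  have perm: "\<pi> permutes {1..n}" using \<pi> by (simp add: S_div_def)
  have \<pi>x: "\<pi> x \<in> {1..n}" using permutes_in_image[OF perm] xn by simp
  \<comment> \<open>A multiple of \<open>x\<close> is a multiple of \<open>m\<close>, and those up
    to \<open>n\<close> stay in the block.\<close>
  have "\<not> x dvd \<pi> x"
  proof
    assume "x dvd \<pi> x"
    then obtain d where d: "\<pi> x = m * (s * d)" unfolding s(3) dvd_def by (auto simp: mult.assoc)
    have "\<pi> x < m * 7" using \<pi>x mn by simp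
    then have "m * (s * d) < m * 7" unfolding d .
    then have "s * d < 7" by (rule mult_less_cancel1[THEN iffD1, THEN conjunct2])
    moreover have "s * d \<ge> 1" using d \<pi>x by (cases "s * d") auto
    ultimately have "s * d \<in> {1..6}" by simp
    then have "\<pi> x \<in> block m" unfolding block_def d by blast
    then show False using out by simp
  qed
  then have dvd: "\<pi> x dvd x" using \<pi> xn by (auto simp: S_div_def)
  \<comment> \<open>Splitting off the gcd leaves \<open>t\<close> coprime to the lost factor
    \<open>d\<close> of \<open>m\<close>, so \<open>t\<close> divides \<open>s\<close>;
    \<open>d = 1\<close> would put \<open>\<pi> x\<close> back in the block.\<close>
  define r where "r = gcd (\<pi> x) m"
  have r0: "r > 0" using m0 by (simp add: r_def)
  obtain t d where td: "\<pi> x = t * r" "m = d * r" "coprime t d"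
    using gcd_coprime_exists[of "\<pi> x" m] m0 unfolding r_def by auto
  have "t * r dvd d * r * s" using dvd unfolding td(1) unfolding s(3) td(2) .
  then have "t dvd d * s" using r0 by (simp add: mult.assoc mult.commute[of r])
  then have "t dvd s" using td(3) by (simp add: coprime_dvd_mult_right_iff)
  then have t: "t \<in> {1..6}" using s by (auto dest: dvd_imp_le intro: dvd_pos_nat simp: Suc_le_eq)
  have "d \<noteq> 1" using t out td by (auto simp: block_def mult.commute)
  then have "d > 84" using mn m0 td(2) by (intro coprime_Q_divisor_gt[of m d]) auto
  then have "84 * r \<le> m" unfolding td(2) by simp
  then have "504 * r \<le> n" using mn by linarith
  moreover have "coprime r Q" using mn(3) td(2) by (simp)
  ultimately show ?thesis using t td(1) by (intro exI[of _ r] exI[of _ t]) (auto simp: mult.commute)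
qed

text \<open>Choose one escaping point per bad block. Blocks are disjoint and \<pi> is injective, so
  the images are distinct products \<open>r * t\<close> with six choices of
  \<open>t\<close>.\<close>

lemma card_bad_sites:
  assumes \<pi>: "\<pi> \<in> S_div n"
  shows "card (sites n - good n \<pi>) \<le> 6 * card {r. 504 * r \<le> n \<and> coprime r Q}"
proof -
  let ?A = "{r. 504 * r \<le> n \<and> coprime r Q}"
  have finA: "finite ?A" by (rule finite_subset[of _ "{..n}"]) auto
  have "\<forall>m\<in>sites n - good n \<pi>. \<exists>x. x \<in> block m \<and> \<pi> x \<notin> block m" by (auto simp: good_def)
  then obtain x where x: "\<And>m. m \<in> sites n - good n \<pi> \<Longrightarrow> x m \<in> block m \<and> \<pi> (x m) \<notin> block m"
    by metis
  have inj: "inj_on (\<lambda>m. \<pi> (x m)) (sites n - good n \<pi>)"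
  proof (rule inj_onI)
    fix m m' assume mm: "m \<in> sites n - good n \<pi>" "m' \<in> sites n - good n \<pi>" "\<pi> (x m) = \<pi> (x m')"
    have "\<pi> permutes {1..n}" using \<pi> by (simp add: S_div_def)
    then have "x m = x m'" using mm(3) permutes_inj by (auto dest: injD)
    then show "m = m'" using block_inj[of m m' "x m"] x[OF mm(1)] x[OF mm(2)] mm
      by (auto simp: sites_def)
  qed
  have "(\<lambda>m. \<pi> (x m)) ` (sites n - good n \<pi>) \<subseteq> (\<lambda>(r, t). r * t) ` (?A \<times> {1..6})"
    using image_outside_block[OF \<pi>] x by (fastforce simp: image_iff)
  then have "card (sites n - good n \<pi>) \<le> card ((\<lambda>(r, t). r * t) ` (?A \<times> {1..6::nat}))"
    using finA by (intro card_inj_on_le[OF inj]) auto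
  also have "\<dots> \<le> card (?A \<times> {1..6::nat})" using finA by (intro card_image_le) auto
  also have "\<dots> = 6 * card ?A" by (simp add: card_cartesian_product)
  finally show ?thesis .
qed

section \<open>Counting rough numbers by residues modulo \<open>Q\<close>\<close>

definition units :: "nat set" where
  "units = {u. u < Q \<and> coprime u Q}"

lemma Q_gt_1: "Q > 1"
proof -
  have "84 \<le> Q" unfolding Q_def by (rule fact_ge_self)
  then show ?thesis by simp
qed

lemma finite_units [simp]: "finite units"
  by (simp add: units_def)

lemma card_units_pos: "card units \<ge> 1"
proof -
  have "1 \<in> units" using Q_gt_1 by (simp add: units_def)
  then show ?thesis by (metis One_nat_def Suc_leI card_gt_0_iff empty_iff finite_units)
qed

lemma coprime_residue: "coprime (q * Q + u) Q \<longleftrightarrow> coprime u Q"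
  by (metis add.commute coprime_iff_gcd_eq_1 gcd.commute gcd_add_mult mult.commute)

lemma inj_on_residue: "inj_on (\<lambda>(q, u). q * Q + u) (I \<times> units)"
proof (rule inj_onI, clarsimp)
  fix q u q' u' assume "u \<in> units" "u' \<in> units" and eq: "q * Q + u = q' * Q + u'"
  then have "u < Q" "u' < Q" by (auto simp: units_def)
  then have "(q * Q + u) div Q = q" "(q' * Q + u') div Q = q'"
    "(q * Q + u) mod Q = u" "(q' * Q + u') mod Q = u'" by auto
  then show "q = q' \<and> u = u'" using eq by metis
qed

text \<open>Every window from \<open>q * Q\<close> up to \<open>Suc q * Q\<close> (excluded) lying
  between n/7 and n/6 contains \<open>card units\<close> rough numbers. The strict bounds on
  \<open>q\<close> discard windows that are cut by an endpoint.\<close>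

lemma card_sites_ge: "(n div Q div 6 - Suc (n div Q div 7)) * card units \<le> card (sites n)"
proof -
  let ?N = "n div Q"
  let ?I = "{Suc (?N div 7)..<?N div 6}"
  have n: "?N * Q \<le> n" "n < Suc ?N * Q" using Q_gt_1 dividend_less_div_times[of Q n] by auto
  have "(\<lambda>(q, u). q * Q + u) ` (?I \<times> units) \<subseteq> sites n"
  proof clarsimp
    fix q u assume q: "Suc (?N div 7) \<le> q" "q < ?N div 6" and u: "u \<in> units"
    have "6 * Suc q \<le> 6 * (?N div 6)" using q(2) by (intro mult_le_mono2 Suc_leI)
    also have "\<dots> \<le> ?N" by simp
    finally have "6 * Suc q \<le> ?N" .
    moreover have "Suc ?N \<le> 7 * Suc (?N div 7)" using dividend_less_div_times[of 7 ?N] by simp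
    then have "Suc ?N \<le> 7 * q" using mult_le_mono2[OF q(1), of 7] by (rule order_trans)
    ultimately have "6 * Suc q * Q \<le> n" "n < 7 * q * Q"
      using n by (meson mult_le_mono1 le_trans less_le_trans)+
    then show "q * Q + u \<in> sites n" using u coprime_residue[of q u]
      by (auto simp: sites_def units_def algebra_simps)
  qed
  then have "card (?I \<times> units) \<le> card (sites n)"
    by (rule card_inj_on_le[OF inj_on_residue]) simp
  then show ?thesis by (simp add: card_cartesian_product)
qed

text \<open>Quotients by \<open>Q\<close> start at 0, hence the \<open>Suc\<close>; a partial last
  window is counted in full.\<close>

lemma card_small_le: "card {r. 504 * r \<le> n \<and> coprime r Q} \<le> Suc (n div Q div 504) * card units"
proof -
  let ?I = "{..n div Q div 504}"
  have "{r. 504 * r \<le> n \<and> coprime r Q} \<subseteq> (\<lambda>(q, u). q * Q + u) ` (?I \<times> units)"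
  proof clarsimp
    fix r assume r: "504 * r \<le> n" "coprime r Q"
    have "r \<le> n div 504" using r by simp
    then have "r div Q \<le> n div 504 div Q" by (rule div_le_mono)
    then have "r div Q \<in> ?I" by (simp add: div_mult2_eq[symmetric] mult.commute)
    moreover have "r mod Q \<in> units"
      using r(2) Q_gt_1 coprime_residue[of "r div Q" "r mod Q"] by (simp add: units_def)
    moreover have "r = r div Q * Q + r mod Q" by simp
    ultimately show "r \<in> (\<lambda>(q, u). q * Q + u) ` (?I \<times> units)" by (intro image_eqI[of _ _ "(r div Q, r mod Q)"]) auto
  qed
  then have "card {r. 504 * r \<le> n \<and> coprime r Q} \<le> card (?I \<times> units)"
    by (rule surj_card_le[rotated]) simp
  then show ?thesis by (simp add: card_cartesian_product)
qed

lemma card_good_ge: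
  assumes \<pi>: "\<pi> \<in> S_div n"
  shows "n div Q \<le> 84 * card (good n \<pi>) + 800"
proof -
  let ?N = "n div Q" and ?u = "card units" and ?g = "card (good n \<pi>)"
  have "good n \<pi> \<subseteq> sites n" by (auto simp: good_def)
  then have "card (sites n) = ?g + card (sites n - good n \<pi>)"
    by (metis add_diff_inverse_nat card_Diff_subset card_mono finite_sites finite_subset not_less)
  then have "(?N div 6 - Suc (?N div 7)) * ?u \<le> ?g + 6 * Suc (?N div 504) * ?u"
    using card_sites_ge[of n] card_bad_sites[OF \<pi>] card_small_le[of n] by linarith
  then have "(?N div 6 - Suc (?N div 7) - 6 * Suc (?N div 504)) * ?u \<le> ?g"
    unfolding diff_mult_distrib[of _ "6 * Suc (?N div 504)"] by linarith
  moreover have "x \<le> x * ?u" for x using card_units_pos by simp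
  ultimately have "?N div 6 - Suc (?N div 7) - 6 * Suc (?N div 504) \<le> ?g" by (rule order_trans[rotated])
  then have "?N div 6 \<le> ?g + 7 + ?N div 7 + 6 * (?N div 504)" by simp
  moreover have "?N < 6 + ?N div 6 * 6" "?N div 7 * 7 \<le> ?N" "?N div 504 * 504 \<le> ?N"
    using dividend_less_div_times[of 6 ?N] by (simp_all only: div_times_less_eq_dividend zero_less_numeral)
  \<comment> \<open>\<open>1/6 - 1/7 - 6/504 = 1/84\<close>. The 7 and the rounding of
    \<open>a\<close> cost at most 8, or 672 after scaling by 84.\<close>
  moreover have "N \<le> 84 * g + 800"
    if "a \<le> g + 7 + b + 6 * c" "N < 6 + a * 6" "b * 7 \<le> N" "c * 504 \<le> N" for N a b c g :: nat
    using that by linarith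
  ultimately show ?thesis by blast
qed

section \<open>Modifying good blocks\<close>

definition swap :: "nat set \<Rightarrow> nat \<Rightarrow> nat" where
  "swap T x = (if x \<in> (*) 2 ` T then x div 2 * 3 else if x \<in> (*) 3 ` T then x div 3 * 2 else x)"

text \<open>\<pi> is overwritten on whole blocks: it maps a good block onto itself but need not
  preserve the pair \<open>2 * m\<close>, \<open>3 * m\<close>.\<close>

definition modify :: "nat set \<Rightarrow> (nat \<Rightarrow> nat) \<Rightarrow> nat \<Rightarrow> nat" where
  "modify T \<pi> x = (if x \<in> \<Union> (block ` T) then swap T x else \<pi> x)"

definition violations :: "nat \<Rightarrow> (nat \<Rightarrow> nat) \<Rightarrow> nat set" where
  "violations n \<pi> = {m \<in> sites n. \<not> (2 * m dvd \<pi> (2 * m) \<or> \<pi> (2 * m) dvd 2 * m)}"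

lemma mem_block: "s \<in> {1..6} \<Longrightarrow> s * m \<in> block m"
  by (auto simp: block_def mult.commute)

text \<open>Makes the two tests in \<open>swap\<close> exclusive: a common value would lie in both
  blocks, forcing \<open>m = m'\<close> and then \<open>m = 0\<close>.\<close>

lemma two_three_disjoint:
  assumes "T \<subseteq> sites n" "m \<in> T" "m' \<in> T"
  shows "2 * m \<noteq> 3 * m'"
proof
  assume eq: "2 * m = 3 * m'"
  have "m = m'" using mem_block[of 2 m] mem_block[of 3 m'] eq assms
    by (intro block_inj[of m m' "2 * m"]) (auto simp: sites_def)
  then show False using eq assms by (auto simp: sites_def)
qed

lemma swap_swap:
  assumes "T \<subseteq> sites n"
  shows "swap T (swap T x) = x"
proof -
  consider (two) m where "m \<in> T" "x = 2 * m" | (three) m where "m \<in> T" "x = 3 * m"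
    | (other) "x \<notin> (*) 2 ` T" "x \<notin> (*) 3 ` T" by blast
  then show ?thesis
  proof cases
    case two
    have "m * 3 \<notin> (*) 2 ` T" using two_three_disjoint[OF assms _ two(1)] by force
    moreover have "m * 3 \<in> (*) 3 ` T" using two by (auto simp: mult.commute)
    ultimately show ?thesis using two by (simp add: swap_def)
  next
    case three
    have "m * 3 \<notin> (*) 2 ` T" using two_three_disjoint[OF assms _ three(1)] by force
    moreover have "m * 2 \<in> (*) 2 ` T" using three by (auto simp: mult.commute)
    ultimately show ?thesis using three by (simp add: swap_def mult.commute)
  next
    case other
    then show ?thesis by (simp add: swap_def)
  qed
qed

text \<open>Disjointness of blocks forces \<open>m' = m\<close> for any exchanged point, and
  \<open>2 * m\<close>, \<open>3 * m\<close> both divide \<open>6 * m\<close>; a fixed point is its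
  own lcm.\<close>

lemma swap_in_block:
  assumes "T \<subseteq> sites n" "m \<in> T" "x \<in> block m"
  shows "swap T x \<in> block m \<and> lcm x (swap T x) \<le> 6 * m"
proof -
  have m: "coprime m Q" "m > 0" using assms by (auto simp: sites_def)
  have le: "lcm x (swap T x) \<le> 6 * m" if "x dvd 6 * m" "swap T x dvd 6 * m"
    using that m by (intro dvd_imp_le lcm_least) auto
  consider (two) m' where "m' \<in> T" "x = 2 * m'" | (three) m' where "m' \<in> T" "x = 3 * m'" "x \<notin> (*) 2 ` T"
    | (other) "x \<notin> (*) 2 ` T" "x \<notin> (*) 3 ` T" by blast
  then show ?thesis
  proof cases
    case two
    have "m' = m" using two mem_block[of 2 m'] assms
      by (intro block_inj[of m' m x]) (auto simp: sites_def)
    then have "x = 2 * m" "swap T x = 3 * m" using two by (auto simp: swap_def)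
    then show ?thesis using le mem_block[of 3 m] by (simp add: mult_dvd_mono)
  next
    case three
    have "m' = m" using three mem_block[of 3 m'] assms
      by (intro block_inj[of m' m x]) (auto simp: sites_def)
    then have "x = 3 * m" "swap T x = 2 * m" using three by (auto simp: swap_def)
    then show ?thesis using le mem_block[of 2 m] by (simp add: mult_dvd_mono)
  next
    case other
    then have "swap T x = x" by (simp add: swap_def)
    then show ?thesis using assms(3) by (auto simp: block_def)
  qed
qed

text \<open>An injective self-map of a finite set is onto. Hence \<pi> preserves the complement of
  the blocks as well.\<close>

lemma image_good_blocks:
  assumes \<pi>: "\<pi> \<in> S_div n" and T: "T \<subseteq> good n \<pi>"
  shows "\<pi> ` \<Union> (block ` T) = \<Union> (block ` T)"
proof -
  have "finite T" by (rule finite_subset[OF T]) (simp add: good_def)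
  moreover have "inj_on \<pi> (\<Union> (block ` T))" using \<pi> by (auto simp: S_div_def intro: permutes_inj_on)
  moreover have "\<pi> ` \<Union> (block ` T) \<subseteq> \<Union> (block ` T)" using T unfolding good_def by blast
  ultimately show ?thesis by (intro endo_inj_surj) auto
qed

lemma modify_in_S_lcm:
  assumes \<pi>: "\<pi> \<in> S_div n" and T: "T \<subseteq> good n \<pi>"
  shows "modify T \<pi> \<in> S_lcm n"
proof -
  let ?U = "\<Union> (block ` T)"
  have Ts: "T \<subseteq> sites n" using T by (auto simp: good_def)
  have perm: "\<pi> permutes {1..n}" using \<pi> by (simp add: S_div_def)
  have U: "?U \<subseteq> {1..n}" using Ts block_subset by blast
  have swU: "swap T x \<in> ?U" if "x \<in> ?U" for x using that swap_in_block[OF Ts] by blast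
  have \<pi>U: "\<pi> x \<in> ?U \<longleftrightarrow> x \<in> ?U" for x
    using image_good_blocks[OF \<pi> T] inj_image_mem_iff[OF permutes_inj[OF perm], of x ?U] by simp
  have \<pi>in: "\<pi> x \<in> {1..n}" if "x \<in> {1..n}" for x using that permutes_in_image[OF perm] by simp
  have "modify T \<pi> permutes {1..n}"
  proof (rule inj_imp_permutes)
    show "inj_on (modify T \<pi>) {1..n}"
    proof (rule inj_onI)
      fix x y assume eq: "modify T \<pi> x = modify T \<pi> y"
      \<comment> \<open>Equal values must come from the same side of \<open>?U\<close>, where either
        the involution \<open>swap T\<close> or \<pi> is injective.\<close>
      have iff: "modify T \<pi> z \<in> ?U \<longleftrightarrow> z \<in> ?U" for z
        using swU[of z] \<pi>U[of z] by (simp add: modify_def)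
      have "x \<in> ?U \<longleftrightarrow> y \<in> ?U" using iff[of x] iff[of y] eq by simp
      then have "swap T x = swap T y \<or> \<pi> x = \<pi> y" using eq by (auto simp: modify_def split: if_splits)
      then show "x = y" using swap_swap[OF Ts] permutes_inj[OF perm] by (metis injD)
    qed
    show "modify T \<pi> x \<in> {1..n}" if "x \<in> {1..n}" for x
      using subsetD[OF U swU[of x]] \<pi>in[OF that] unfolding modify_def by presburger
    show "modify T \<pi> x = x" if "x \<notin> {1..n}" for x
      using that U permutes_not_in[OF perm that] unfolding modify_def by (auto split: if_splits)
  qed simp
  moreover have "lcm x (modify T \<pi> x) \<le> n" if x: "x \<in> {1..n}" for x
  proof (cases "x \<in> ?U")
    case True
    then obtain m where m: "m \<in> T" "x \<in> block m" by blast
    then have "lcm x (swap T x) \<le> 6 * m" using swap_in_block[OF Ts] by blast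
    also have "\<dots> \<le> n" using m Ts by (auto simp: sites_def)
    finally show ?thesis using True by (simp add: modify_def)
  next
    case False
    have "x dvd \<pi> x \<or> \<pi> x dvd x" using \<pi> x by (simp add: S_div_def)
    \<comment> \<open>Under divisibility the lcm is one of the two numbers, both at most
      \<open>n\<close>.\<close>
    then have "lcm x (\<pi> x) = \<pi> x \<or> lcm x (\<pi> x) = x" by (auto simp: lcm_proj1_iff lcm_proj2_iff)
    then show ?thesis using False x \<pi>in[OF x] by (auto simp: modify_def)
  qed
  ultimately show ?thesis by (simp add: S_lcm_def)
qed

text \<open>For \<open>m\<close> in \<open>T\<close> the value at \<open>2 * m\<close> is
  \<open>3 * m\<close>, and neither divides the other. For other sites \<open>2 * m\<close> is in no
  block of \<open>T\<close>, so \<pi> still acts there.\<close>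

lemma violations_modify:
  assumes \<pi>: "\<pi> \<in> S_div n" and T: "T \<subseteq> good n \<pi>"
  shows "violations n (modify T \<pi>) = T"
proof -
  have Ts: "T \<subseteq> sites n" using T by (auto simp: good_def)
  have "\<not> (2 * m dvd modify T \<pi> (2 * m) \<or> modify T \<pi> (2 * m) dvd 2 * m) \<longleftrightarrow> m \<in> T"
    if m: "m \<in> sites n" for m
  proof (cases "m \<in> T")
    case True
    then have "modify T \<pi> (2 * m) = 3 * m"
      using mem_block[of 2 m] by (auto simp: modify_def swap_def)
    moreover have "m > 0" using m by (auto simp: sites_def)
    ultimately show ?thesis using True by simp
  next
    case False
    have "2 * m \<notin> block m'" if "m' \<in> T" for m'
    proof
      assume "2 * m \<in> block m'"
      then have "m = m'" using that Ts m mem_block[of 2 m]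
        by (intro block_inj[of m m' "2 * m"]) (auto simp: sites_def)
      then show False using that False by simp
    qed
    then have "modify T \<pi> (2 * m) = \<pi> (2 * m)" by (auto simp: modify_def)
    moreover have "2 * m \<in> {1..n}" using m by (auto simp: sites_def)
    ultimately show ?thesis using False \<pi> by (auto simp: S_div_def)
  qed
  then show ?thesis using Ts unfolding violations_def by blast
qed

section \<open>Weighted double counting\<close>

lemma sum_power_card_Pow:
  fixes w :: real
  assumes "finite G"
  shows "(\<Sum>T\<in>Pow G. w ^ card T) = (1 + w) ^ card G"
  using prod_add[OF assms, of "\<lambda>_. w" "\<lambda>_. 1"] by (simp add: add.commute)

lemma finite_S_div: "finite (S_div n)"
  by (rule finite_subset[OF _ finite_permutations[of "{1..n}"]]) (auto simp: S_div_def)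

lemma finite_S_lcm: "finite (S_lcm n)"
  by (rule finite_subset[OF _ finite_permutations[of "{1..n}"]]) (auto simp: S_lcm_def)

text \<open>Possible records of the values erased by \<open>modify\<close>. Admitting all self-maps
  of a block, not only bijections, gives the constant \<open>6 ^ 6\<close>.\<close>

definition block_maps :: "nat set \<Rightarrow> (nat \<Rightarrow> nat \<Rightarrow> nat) set" where
  "block_maps T = (\<Pi>\<^sub>E m\<in>T. block m \<rightarrow>\<^sub>E block m)"

lemma card_block_maps:
  assumes "T \<subseteq> sites n"
  shows "card (block_maps T) = (6 ^ 6) ^ card T"
proof -
  have "finite T" using assms by (rule finite_subset) simp
  then have "card (block_maps T) = (\<Prod>m\<in>T. card (block m) ^ card (block m))"
    unfolding block_maps_def by (simp add: card_PiE)
  also have "\<dots> = (\<Prod>m\<in>T. 6 ^ 6)"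
    using assms by (intro prod.cong) (auto simp: sites_def card_block)
  finally show ?thesis by simp
qed

lemma finite_block_maps: "T \<subseteq> sites n \<Longrightarrow> finite (block_maps T)"
  unfolding block_maps_def by (intro finite_PiE) (auto intro: finite_subset)

lemma restrict_mem_block_maps:
  assumes "T \<subseteq> good n \<pi>"
  shows "(\<lambda>m\<in>T. restrict \<pi> (block m)) \<in> block_maps T"
  using assms unfolding block_maps_def restrict_PiE_iff good_def by blast

text \<open>\<open>violations\<close> recovers \<open>T\<close>; then \<pi> is read from the record
  on the blocks of \<open>T\<close> and from \<open>modify T \<pi>\<close> elsewhere.\<close>

lemma inj_on_modify_record:
  "inj_on (\<lambda>(\<pi>, T). (modify T \<pi>, \<lambda>m\<in>T. restrict \<pi> (block m))) (SIGMA \<pi>:S_div n. Pow (good n \<pi>))"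
proof (rule inj_onI, clarify)
  fix \<pi> \<pi>' T T'
  assume \<pi>: "\<pi> \<in> S_div n" "T \<subseteq> good n \<pi>" and \<pi>': "\<pi>' \<in> S_div n" "T' \<subseteq> good n \<pi>'"
    and mod: "modify T \<pi> = modify T' \<pi>'"
    and rec: "(\<lambda>m\<in>T. restrict \<pi> (block m)) = (\<lambda>m\<in>T'. restrict \<pi>' (block m))"
  have T: "T = T'" using violations_modify[OF \<pi>] violations_modify[OF \<pi>'] mod by simp
  have "\<pi> x = \<pi>' x" for x
  proof (cases "x \<in> \<Union> (block ` T)")
    case True
    then obtain m where m: "m \<in> T" "x \<in> block m" by blast
    have "restrict \<pi> (block m) x = restrict \<pi>' (block m) x"
      using fun_cong[OF rec, of m] m(1) T by simp
    then show ?thesis using m(2) by simp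
  next
    case False
    then show ?thesis using fun_cong[OF mod, of x] T by (simp add: modify_def)
  qed
  then show "\<pi> = \<pi>' \<and> T = T'" using T by auto
qed

lemma sum_good_le_card_S_lcm:
  "(\<Sum>\<pi>\<in>S_div n. (1 + 1 / 6 ^ 6) ^ card (good n \<pi>)) \<le> real (card (S_lcm n))"
proof -
  \<comment> \<open>Reciprocal of the number of self-maps of a block, so that all records above one
    \<open>\<rho>\<close> have total weight 1.\<close>
  define w :: real where "w = 1 / 6 ^ 6"
  let ?X = "SIGMA \<pi>:S_div n. Pow (good n \<pi>)"
  let ?Y = "SIGMA \<rho>:S_lcm n. block_maps (violations n \<rho>)"
  let ?\<Phi> = "\<lambda>(\<pi>, T). (modify T \<pi>, \<lambda>m\<in>T. restrict \<pi> (block m))"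
  have w: "w \<ge> 0" by (simp add: w_def)
  have viol: "violations n \<rho> \<subseteq> sites n" for \<rho> by (auto simp: violations_def)
  have fin_good: "finite (good n \<pi>)" for \<pi> by (simp add: good_def)
  have finY: "finite ?Y"
    using finite_S_lcm finite_block_maps[OF viol] by (intro finite_SigmaI) auto
  have sub: "?\<Phi> ` ?X \<subseteq> ?Y"
    using modify_in_S_lcm violations_modify restrict_mem_block_maps by auto
  have "(\<Sum>\<pi>\<in>S_div n. (1 + w) ^ card (good n \<pi>)) = (\<Sum>\<pi>\<in>S_div n. \<Sum>T\<in>Pow (good n \<pi>). w ^ card T)"
    by (simp add: sum_power_card_Pow fin_good)
  also have "\<dots> = (\<Sum>(\<pi>, T)\<in>?X. w ^ card T)"
    using finite_S_div fin_good by (intro sum.Sigma) auto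
  \<comment> \<open>Expressing the weight through the image lets the sum be transported along the
    injection.\<close>
  also have "\<dots> = (\<Sum>z\<in>?X. w ^ card (violations n (fst (?\<Phi> z))))"
    using violations_modify by (intro sum.cong) auto
  also have "\<dots> = (\<Sum>y\<in>?\<Phi> ` ?X. w ^ card (violations n (fst y)))"
    by (subst sum.reindex[OF inj_on_modify_record]) simp
  also have "\<dots> \<le> (\<Sum>y\<in>?Y. w ^ card (violations n (fst y)))"
    using finY sub w by (intro sum_mono2) auto
  also have "\<dots> = (\<Sum>(\<rho>, \<sigma>)\<in>?Y. w ^ card (violations n \<rho>))"
    by (intro sum.cong) auto
  also have "\<dots> = (\<Sum>\<rho>\<in>S_lcm n. \<Sum>\<sigma>\<in>block_maps (violations n \<rho>). w ^ card (violations n \<rho>))"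
    using finite_S_lcm finite_block_maps[OF viol] by (intro sum.Sigma[symmetric]) auto
  also have "\<dots> = (\<Sum>\<rho>\<in>S_lcm n. 1)"
    by (intro sum.cong) (auto simp: card_block_maps[OF viol] w_def power_one_over)
  finally show ?thesis by (simp add: w_def)
qed

section \<open>The exponential lower bound for \<open>R\<close>\<close>

lemma R_ge:
  assumes "\<And>\<pi>. \<pi> \<in> S_div n \<Longrightarrow> g \<le> card (good n \<pi>)"
  shows "R n \<ge> (1 + 1 / 6 ^ 6) ^ g"
proof -
  have "id \<in> S_div n" by (simp add: S_div_def permutes_id)
  then have "card (S_div n) > 0" using finite_S_div by (auto simp: card_gt_0_iff)
  have "real (card (S_div n)) * (1 + 1 / 6 ^ 6) ^ g = (\<Sum>\<pi>\<in>S_div n. (1 + 1 / 6 ^ 6) ^ g)" by simp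
  also have "\<dots> \<le> (\<Sum>\<pi>\<in>S_div n. (1 + 1 / 6 ^ 6) ^ card (good n \<pi>))"
    using assms by (intro sum_mono power_increasing) auto
  also have "\<dots> \<le> real (card (S_lcm n))" by (rule sum_good_le_card_S_lcm)
  finally show ?thesis using \<open>card (S_div n) > 0\<close> by (simp add: R_def field_simps)
qed

theorem theorem5:
  shows "\<exists>c::real. c > 1 \<and> (\<forall>\<^sub>F n in sequentially. R n > c ^ n)"
proof -
  define b :: real where "b = 1 + 1 / 6 ^ 6"
  \<comment> \<open>Chosen so that \<open>b ^ g\<close> is \<open>c\<close> to the power
    \<open>200 * Q * g\<close>, an exponent shown below to exceed \<open>n\<close>.\<close>
  define c where "c = root (200 * Q) b"
  have b: "b > 1" by (simp add: b_def)
  have c: "c > 1" using b Q_gt_1 by (simp add: c_def)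
  have cb: "c ^ (200 * Q) = b" using b Q_gt_1 by (simp add: c_def)
  have "R n > c ^ n" if n: "n \<ge> 2000 * Q" for n
  proof -
    let ?N = "n div Q"
    define g where "g = (?N - 800) div 84"
    have "?N \<ge> 2000" using n Q_gt_1 by (simp add: less_eq_div_iff_mult_less_eq)
    \<comment> \<open>Since 200/84 exceeds 2, \<open>?N \<ge> 2000\<close> absorbs both the 800 and
      the rounding.\<close>
    then have "Suc ?N \<le> 200 * g" unfolding g_def by linarith
    then have "Suc ?N * Q \<le> 200 * g * Q" by (rule mult_le_mono1)
    moreover have "n < Suc ?N * Q" using Q_gt_1 dividend_less_div_times[of Q n] by simp
    ultimately have "n < 200 * Q * g" by (simp add: mult_ac)
    then have "c ^ n < c ^ (200 * Q * g)" using c by (intro power_strict_increasing)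
    also have "\<dots> = b ^ g" by (simp only: power_mult[of c "200 * Q"] cb)
    also have "\<dots> \<le> R n" unfolding b_def
    proof (rule R_ge)
      fix \<pi> assume "\<pi> \<in> S_div n"
      then have "?N \<le> 84 * card (good n \<pi>) + 800" by (rule card_good_ge)
      then show "g \<le> card (good n \<pi>)" unfolding g_def by linarith
    qed
    finally show ?thesis .
  qed
  then show ?thesis using c unfolding eventually_sequentially by blast
qed

end
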